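(* Let $X, X_1, X_2, \ldots$ be i.i.d. real-valued random variables, and let $S_n = \sum_{i=1}^n X_i$ and $G_n = \frac1n \sum_{i=1}^n S_i$ for $n \ge 1$. Suppose that either of the following two conditions holds. (i) $\mathbb{E}|X| \in (0,\infty)$ and $X$ has the same distribution as $-X$. (ii) $\mathbb{E}[X^2] < \infty$, $\mathrm{Var}(X) > 0$, and $\mathbb{E} X = 0$. Then, almost surely, $\liminf_{n\to\infty} G_n = -\infty$ and $\limsup_{n \to \infty} G_n = +\infty$; and, for any $x \in \mathbb{R}$, $\liminf_{n\to\infty} |G_n - x| = 0$ almost surely. *)

theory Defs
  imports "HOL-Probability.Probability"
begin

definition partial_sum :: "(nat \<Rightarrow> 'a \<Rightarrow> real) \<Rightarrow> nat \<Rightarrow> 'a \<Rightarrow> real" where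
  "partial_sum X n \<omega> = (\<Sum>i = 1..n. X i \<omega>)"

definition avg_partial_sum :: "(nat \<Rightarrow> 'a \<Rightarrow> real) \<Rightarrow> nat \<Rightarrow> 'a \<Rightarrow> real" where
  "avg_partial_sum X n \<omega> = (1 / real n) * (\<Sum>i = 1..n. partial_sum X i \<omega>)"

text \<open>
  \<open>X\<close> is a generic copy of the sequence members; only its law matters,
  so independence is required of \<open>Xs 1, Xs 2, \<dots>\<close> alone (\<open>Xs 0\<close> is unconstrained and never used).
\<close>
definition iid_copies :: "'a measure \<Rightarrow> ('a \<Rightarrow> real) \<Rightarrow> (nat \<Rightarrow> 'a \<Rightarrow> real) \<Rightarrow> bool" where
  "iid_copies M X Xs \<longleftrightarrow>
     X \<in> borel_measurable M \<and>
     prob_space.indep_vars M (\<lambda>_. borel) Xs {1..} \<and>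
     (\<forall>i\<ge>1. distr M borel (Xs i) = distr M borel X)"

end

theory Submission
  imports Defs
begin

text \<open>
  Almost sure statements about an i.i.d. sequence depend only on its law, so everything takes place
  on the product space of sequences \<open>y\<close>, where \<open>walk y n\<close> is the random walk and \<open>centre y n\<close>
  its centre of mass. The measure-preserving map \<open>shift\<close> drops the first step.

  The increments of the centre of mass are \<open>(walk y (Suc n) - centre y n) / Suc n\<close>. By the strong law
  of large numbers they tend to \<open>0\<close>, so a trajectory with upper limit \<open>\<infinity>\<close> and lower
  limit \<open>-\<infinity>\<close> passes arbitrarily close to every level infinitely often. It remains
  to find the two limits, and by reflection it is enough to treat the upper one,
  \<open>L y = limsup (centre y)\<close>.

  The sublinear growth of the walk gives, almost surely, \<open>L y = y 0 + L (shift y)\<close>. Hence the events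
  \<open>L = \<infinity>\<close> and \<open>L = -\<infinity>\<close> are shift invariant and have probability \<open>0\<close> or \<open>1\<close>. If both had
  probability \<open>0\<close>, then \<open>L\<close> would be a finite random variable with the law of \<open>X + L\<close>, where \<open>X\<close> and
  \<open>L\<close> are independent; comparing characteristic functions near \<open>0\<close> forces \<open>X = 0\<close>, against
  the assumption that the steps are nontrivial. So \<open>L\<close> is almost surely one of the two infinite values
  (lemma \<open>limsup_centre_infinite\<close>).

  The value \<open>-\<infinity>\<close> is excluded as follows. For a symmetric law, reflection
  would make the lower limit equal to \<open>\<infinity>\<close> at the same time. For a centred law with
  finite variance, the centre would eventually be negative, so the probability that it is positive
  tends to \<open>0\<close>; as its mean is \<open>0\<close> and its second moment is \<open>O(n)\<close>, its absolute moment would be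
  \<open>o(sqrt n)\<close>, and the characteristic function of \<open>centre y n / sqrt n\<close> would tend to \<open>1\<close>. Writing
  the centre as a weighted sum of independent steps bounds that function away from \<open>1\<close>.

  The strong law for integrable steps follows from the same \<open>0\<close>-\<open>1\<close> law and from
  the maximal ergodic inequality: a walk with negative drift is almost surely bounded above.
\<close>

section \<open>Walks, centres of mass and the Bernoulli shift\<close>

definition walk :: "(nat \<Rightarrow> real) \<Rightarrow> nat \<Rightarrow> real" where
  "walk y n = (\<Sum>i<n. y i)"

definition centre :: "(nat \<Rightarrow> real) \<Rightarrow> nat \<Rightarrow> real" where
  "centre y n = (\<Sum>i=1..n. walk y i) / real n"

definition shift :: "(nat \<Rightarrow> real) \<Rightarrow> nat \<Rightarrow> real" where
  "shift y = (\<lambda>i. y (Suc i))"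

locale iid_sequence = real_distribution \<mu> for \<mu> :: "real measure"
begin

abbreviation S :: "(nat \<Rightarrow> real) measure" where
  "S \<equiv> PiM UNIV (\<lambda>_. \<mu>)"

sublocale S: sequence_space \<mu>
  by unfold_locales

lemma space_S [simp]: "space S = UNIV"
  by (simp add: space_PiM)

lemma prob_UNIV [simp]: "prob UNIV = 1"
  using prob_space by simp

lemma S_prob_UNIV [simp]: "S.prob UNIV = 1"
  using prob_space.prob_space[OF prob_space_PiM[of "UNIV :: nat set" "\<lambda>_. \<mu>"]] prob_space_axioms
  by simp

lemma sets_S [measurable_cong]: "sets S = sets (PiM UNIV (\<lambda>_. borel))"
  by (intro sets_PiM_cong) auto

lemma measurable_coord [measurable]: "(\<lambda>y. y i) \<in> borel_measurable S"
  by (simp add: measurable_cong_sets[OF sets_S refl])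

lemma measurable_coord_law [measurable]: "(\<lambda>y. y i) \<in> measurable S \<mu>"
  by simp

lemma measurable_shift [measurable]: "shift \<in> measurable S S"
  unfolding shift_def
  by (rule measurable_PiM_single') (auto simp: measurable_coord_law)

text \<open>
  The one-dimensional marginals and the independence of the coordinates identify the coordinate
  process on \<open>S\<close> as the canonical i.i.d. sequence with step law \<open>\<mu>\<close>.
\<close>
lemma distr_coord: "distr S borel (\<lambda>y. y i) = \<mu>"
proof -
  have "distr S borel (\<lambda>y. y i) = distr S \<mu> (\<lambda>y. y i)"
    by (intro distr_cong) auto
  also have "\<dots> = \<mu>"
    by (rule distr_PiM_component) (auto intro: prob_space_axioms)
  finally show ?thesis .
qed

lemma indep_coords: "S.indep_vars (\<lambda>_. borel) (\<lambda>i y. y i) UNIV"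
proof (subst S.indep_vars_iff_distr_eq_PiM)
  have "distr S (PiM UNIV (\<lambda>_. borel)) (\<lambda>y. y) = S"
    by (rule distr_id2) (simp add: sets_S)
  then show "distr S (PiM UNIV (\<lambda>_. borel)) (\<lambda>x. \<lambda>i\<in>UNIV. x i) = PiM UNIV (\<lambda>i. distr S borel (\<lambda>y. y i))"
    by (simp add: distr_coord restrict_UNIV)
qed auto

lemma S_split: "distr (\<mu> \<Otimes>\<^sub>M S) S (\<lambda>(x, y). case_nat x y) = S"
  by (rule S.PiM_iter)

text \<open>
  Split off the first coordinate: \<open>S\<close> is the law of a step followed by an independent sequence,
  and the shift recovers that sequence.
\<close>
lemma distr_shift: "distr S S shift = S"
proof -
  have "distr S S shift = distr (distr (\<mu> \<Otimes>\<^sub>M S) S (\<lambda>(x, y). case_nat x y)) S shift"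
    by (simp add: S_split)
  also have "\<dots> = distr (\<mu> \<Otimes>\<^sub>M S) S snd"
    by (subst distr_distr) (auto simp: shift_def comp_def split_beta' intro!: distr_cong)
  also have "\<dots> = distr (S \<Otimes>\<^sub>M \<mu>) S fst"
  proof -
    interpret P: pair_prob_space \<mu> S by unfold_locales
    show ?thesis
      by (subst P.distr_pair_swap) (auto simp: distr_distr comp_def split_beta' intro!: distr_cong)
  qed
  also have "\<dots> = S"
    by (rule distr_pair_fst)
  finally show ?thesis .
qed

text \<open>
  A shift-invariant event is its own preimage under every power of the shift, so it is determined
  by the coordinates from \<open>n\<close> on, for each \<open>n\<close>: it is a tail event, and Kolmogorov's law applies.
\<close>
lemma shift_invariant_0_1:
  assumes A [measurable]: "A \<in> sets S" and inv: "\<And>y. shift y \<in> A \<longleftrightarrow> y \<in> A"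
  shows "S.prob A = 0 \<or> S.prob A = 1"
proof (rule S.kolmogorov_0_1_law)
  let ?F = "\<lambda>i. {(\<lambda>y::nat \<Rightarrow> real. y i) -` B \<inter> space S |B. B \<in> sets borel}"
  show "S.indep_sets ?F UNIV"
    using indep_coords by (auto simp: S.indep_vars_def2)
  show "sigma_algebra (space S) (?F i)" for i
    using sets.sigma_algebra_axioms[of "vimage_algebra (space S) (\<lambda>y. y i) (borel :: real measure)"]
    by (simp add: sets_vimage_algebra2)
  show "A \<in> S.tail_events ?F"
    unfolding S.tail_events_def
  proof (rule INT_I)
    fix n
    let ?N = "sigma (space S) (\<Union>i\<in>{n..}. ?F i)"
    have inv_n: "(\<lambda>i. y (i + n)) \<in> A \<longleftrightarrow> y \<in> A" for y
    proof (induction n arbitrary: y)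
      case (Suc n)
      from Suc[of "shift y"] show ?case by (simp add: inv) (simp add: shift_def)
    qed simp
    have "(\<lambda>y i. y (i + n)) \<in> measurable ?N (PiM UNIV (\<lambda>_. borel))"
    proof (rule measurable_PiM_single')
      fix i
      show "(\<lambda>y. y (i + n)) \<in> measurable ?N borel"
        by (rule measurableI) (auto intro!: bexI[of _ "i + n"] sigma_sets.Basic, blast)
    qed auto
    then have "(\<lambda>y i. y (i + n)) -` A \<inter> space ?N \<in> sets ?N"
      by (rule measurable_sets) (use A in \<open>simp add: sets_S\<close>)
    also have "(\<lambda>y i. y (i + n)) -` A \<inter> space ?N = A"
      by (auto simp: inv_n)
    finally show "A \<in> sigma_sets (space S) (\<Union>i\<in>{n..}. ?F i)"
      by simp
  qed
qed

end

section \<open>The strong law of large numbers\<close>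

lemma walk_0 [simp]: "walk y 0 = 0"
  by (simp add: walk_def)

lemma walk_Suc_shift: "walk y (Suc n) = y 0 + walk (shift y) n"
  by (simp add: walk_def shift_def sum.lessThan_Suc_shift del: sum.lessThan_Suc)

text \<open>
  Dropping the first step moves all later positions by the same constant. This is the invariance
  that makes boundedness of the walk subject to the \<open>0\<close>-\<open>1\<close> law.
\<close>
lemma bdd_above_walk_shift:
  "bdd_above (range (walk (shift y))) \<longleftrightarrow> bdd_above (range (walk y))"
proof
  assume "bdd_above (range (walk (shift y)))"
  then obtain C where C: "walk (shift y) n \<le> C" for n
    by (auto simp: bdd_above_def)
  have "walk y n \<le> max 0 (y 0 + C)" for n
    using C by (cases n) (auto simp: walk_Suc_shift le_max_iff_disj)
  then show "bdd_above (range (walk y))"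
    by (intro bdd_aboveI[of _ "max 0 (y 0 + C)"]) auto
next
  assume "bdd_above (range (walk y))"
  then obtain C where C: "walk y n \<le> C" for n
    by (auto simp: bdd_above_def)
  have "walk (shift y) n \<le> C - y 0" for n
    using C[of "Suc n"] by (simp add: walk_Suc_shift)
  then show "bdd_above (range (walk (shift y)))"
    by (intro bdd_aboveI[of _ "C - y 0"]) auto
qed

text \<open>
  This is the maximum of \<open>walk y 0, \<dots>, walk y n\<close>, written as Lindley's recursion. In this form it
  refers to the same functional of the shifted sequence, which is what the maximal inequality needs.
\<close>
primrec running_max :: "nat \<Rightarrow> (nat \<Rightarrow> real) \<Rightarrow> real" where
  "running_max 0 y = 0"
| "running_max (Suc n) y = max 0 (y 0 + running_max n (shift y))"

lemma running_max_nonneg: "running_max n y \<ge> 0"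
  by (cases n) auto

lemma running_max_mono: "running_max n y \<le> running_max (Suc n) y"
proof (induction n arbitrary: y)
  case (Suc n)
  from Suc[of "shift y"] show ?case by (auto simp: max_def)
qed simp

lemma walk_le_running_max: "walk y n \<le> running_max n y"
proof (induction n arbitrary: y)
  case (Suc n)
  from Suc[of "shift y"] show ?case by (simp add: walk_Suc_shift le_max_iff_disj)
qed simp

text \<open>
  The right-hand side bounds all times at once. It therefore passes directly to shifts and
  averages.
\<close>
lemma sublinear_iff:
  fixes f :: "nat \<Rightarrow> real"
  shows "(\<lambda>n. f n / n) \<longlonglongrightarrow> 0 \<longleftrightarrow> (\<forall>e>0::real. \<exists>C. \<forall>n. \<bar>f n\<bar> \<le> e * n + C)"
proof (intro iffI allI impI)
  fix e :: real
  assume "(\<lambda>n. f n / n) \<longlonglongrightarrow> 0" "e > 0"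
  then obtain N where N: "\<And>n. n \<ge> N \<Longrightarrow> \<bar>f n / n\<bar> < e"
    using LIMSEQ_D by fastforce
  have "\<bar>f n\<bar> \<le> e * n + (\<Sum>i\<le>N. \<bar>f i\<bar>)" for n
  proof (cases "n \<le> N")
    case True
    then have "\<bar>f n\<bar> \<le> (\<Sum>i\<le>N. \<bar>f i\<bar>)"
      by (intro member_le_sum) auto
    then show ?thesis using \<open>e > 0\<close> by (simp add: add_increasing)
  next
    case False
    then have "\<bar>f n\<bar> \<le> e * n"
      using N[of n] by (simp add: field_simps)
    then show ?thesis by (simp add: add_increasing2 sum_nonneg)
  qed
  then show "\<exists>C. \<forall>n. \<bar>f n\<bar> \<le> e * n + C" by blast
next
  assume R: "\<forall>e>0::real. \<exists>C. \<forall>n. \<bar>f n\<bar> \<le> e * n + C"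
  show "(\<lambda>n. f n / n) \<longlonglongrightarrow> 0"
  proof (rule LIMSEQ_I)
    fix r :: real
    assume "r > 0"
    then obtain C where C: "\<bar>f n\<bar> \<le> r / 2 * n + C" for n
      using R half_gt_zero by blast
    obtain N :: nat where N: "C / (r / 2) < N"
      using reals_Archimedean2 by blast
    show "\<exists>no. \<forall>n\<ge>no. norm (f n / n - 0) < r"
    proof (intro exI allI impI)
      fix n assume n: "Suc N \<le> n"
      then have "C / (r / 2) < n" using N by linarith
      then have "C < r / 2 * n" using \<open>r > 0\<close> by (simp add: field_simps)
      then have "\<bar>f n\<bar> < r * n" using C[of n] by simp
      then show "norm (f n / n - 0) < r"
        using n by (simp add: field_simps)
    qed
  qed
qed

lemma walk_sublinear_shift:
  "(\<lambda>n. walk (shift y) n / n) \<longlonglongrightarrow> 0 \<longleftrightarrow> (\<lambda>n. walk y n / n) \<longlonglongrightarrow> 0"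
  unfolding sublinear_iff
proof (intro iffI allI impI)
  fix e :: real
  assume "\<forall>e>0::real. \<exists>C. \<forall>n. \<bar>walk (shift y) n\<bar> \<le> e * n + C" "e > 0"
  then obtain C where C: "\<bar>walk (shift y) n\<bar> \<le> e * n + C" for n by blast
  have "\<bar>walk y n\<bar> \<le> e * n + (\<bar>y 0\<bar> + \<bar>C\<bar>)" for n
  proof (cases n)
    case (Suc m)
    then show ?thesis
      using C[of m] \<open>e > 0\<close> by (simp add: walk_Suc_shift algebra_simps)
  qed simp
  then show "\<exists>C. \<forall>n. \<bar>walk y n\<bar> \<le> e * n + C" by blast
next
  fix e :: real
  assume "\<forall>e>0::real. \<exists>C. \<forall>n. \<bar>walk y n\<bar> \<le> e * n + C" "e > 0"
  then obtain C where C: "\<bar>walk y n\<bar> \<le> e * n + C" for n by blast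
  have "\<bar>walk (shift y) n\<bar> \<le> e * n + (e + C + \<bar>y 0\<bar>)" for n
    using C[of "Suc n"] by (simp add: walk_Suc_shift algebra_simps)
  then show "\<exists>C. \<forall>n. \<bar>walk (shift y) n\<bar> \<le> e * n + C" by blast
qed

text \<open>
  Subtracting an arbitrarily small drift from the walk, or from its reflection, already leaves a
  walk that is bounded above; the countably many drifts \<open>1 / Suc k\<close> suffice.
\<close>
lemma walk_sublinear_of_drifts:
  assumes upper: "\<And>k. bdd_above (range (walk (\<lambda>i. y i - 1 / Suc k)))"
    and lower: "\<And>k. bdd_above (range (walk (\<lambda>i. - y i - 1 / Suc k)))"
  shows "(\<lambda>n. walk y n / n) \<longlonglongrightarrow> 0"
  unfolding sublinear_iff
proof (intro allI impI)
  fix e :: real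
  assume "e > 0"
  then obtain k where k: "1 / Suc k < e"
    by (rule nat_approx_posE)
  obtain C where C: "walk y n - n * (1 / Suc k) \<le> C" for n
    using upper[of k] by (auto simp: bdd_above_def walk_def sum_subtractf)
  obtain D where D: "- walk y n - n * (1 / Suc k) \<le> D" for n
    using lower[of k] by (auto simp: bdd_above_def walk_def sum_subtractf sum_negf)
  have "\<bar>walk y n\<bar> \<le> e * n + max C D" for n
  proof -
    have "n * (1 / Suc k) \<le> n * e"
      using k by (intro mult_left_mono) auto
    then show ?thesis
      using C[of n] D[of n] unfolding abs_le_iff by (simp only: mult.commute[of e]) linarith
  qed
  then show "\<exists>C. \<forall>n. \<bar>walk y n\<bar> \<le> e * n + C" by blast
qed

context iid_sequence
begin

lemma integral_shift:
  fixes g :: "(nat \<Rightarrow> real) \<Rightarrow> real"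
  assumes [measurable]: "g \<in> borel_measurable S"
  shows "S.expectation (\<lambda>y. g (shift y)) = S.expectation g"
proof -
  have "S.expectation g = integral\<^sup>L (distr S S shift) g"
    by (simp add: distr_shift)
  also have "\<dots> = S.expectation (\<lambda>y. g (shift y))"
    by (rule integral_distr) auto
  finally show ?thesis by simp
qed

lemma integrable_shift:
  fixes g :: "(nat \<Rightarrow> real) \<Rightarrow> real"
  assumes "integrable S g"
  shows "integrable S (\<lambda>y. g (shift y))"
proof -
  have "integrable (distr S S shift) g"
    using assms by (simp add: distr_shift)
  then show ?thesis by (rule integrable_distr[OF measurable_shift])
qed

lemma integrable_coord:
  fixes f :: "real \<Rightarrow> real"
  assumes [measurable]: "f \<in> borel_measurable borel" and "integrable \<mu> f"
  shows "integrable S (\<lambda>y. f (y i))"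
  using integrable_distr_eq[of "\<lambda>y. y i" S borel f] assms by (simp add: distr_coord)

lemma integral_coord:
  fixes f :: "real \<Rightarrow> real"
  assumes [measurable]: "f \<in> borel_measurable borel"
  shows "S.expectation (\<lambda>y. f (y i)) = expectation f"
  using integral_distr[of "\<lambda>y. y i" S borel f] assms by (simp add: distr_coord)

lemma measurable_walk [measurable]:
  assumes [measurable]: "f \<in> borel_measurable borel"
  shows "(\<lambda>y. walk (\<lambda>i. f (y i)) n) \<in> borel_measurable S"
  unfolding walk_def by measurable

lemma measurable_running_max [measurable]:
  assumes [measurable]: "f \<in> borel_measurable borel"
  shows "(\<lambda>y. running_max n (\<lambda>i. f (y i))) \<in> borel_measurable S"
proof (induction n)
  case (Suc n)
  have "(\<lambda>y. running_max n (\<lambda>i. f (shift y i))) \<in> borel_measurable S"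
    using measurable_compose[OF measurable_shift Suc] .
  then show ?case by (simp add: shift_def)
qed simp

lemma integrable_running_max:
  assumes [measurable]: "f \<in> borel_measurable borel" and f: "integrable \<mu> f"
  shows "integrable S (\<lambda>y. running_max n (\<lambda>i. f (y i)))"
proof (induction n)
  case (Suc n)
  from integrable_shift[OF Suc] integrable_coord[OF assms] show ?case
    by (simp add: shift_def)
qed simp

text \<open>
  The maximal ergodic inequality, by Garsia's argument: where the running maximum is positive it
  is at most the first step plus the running maximum of the shifted sequence, and elsewhere it is
  \<open>0\<close>. The two running maxima have the same expectation, so they cancel on integration.
\<close>
lemma maximal_inequality:
  assumes [measurable]: "f \<in> borel_measurable borel" and f: "integrable \<mu> f"
  shows "S.expectation (\<lambda>y. f (y 0) * indicator {y. running_max n (\<lambda>i. f (y i)) > 0} y) \<ge> 0"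
proof (cases n)
  case (Suc m)
  let ?R = "\<lambda>n y. running_max n (\<lambda>i. f (y i))"
  let ?g = "\<lambda>y. f (y 0) * indicator {y. ?R n y > 0} y"
  have [measurable]: "{y. ?R n y > 0} \<in> sets S"
    using borel_measurable_less[of "\<lambda>_. 0" S "?R n"] by simp
  have g: "integrable S ?g"
    by (rule Bochner_Integration.integrable_bound[OF integrable_coord[OF assms, of 0]])
       (auto simp: indicator_def)
  have "S.expectation (?R n) \<le> S.expectation (\<lambda>y. ?g y + ?R n (shift y))"
  proof (rule integral_mono)
    show "integrable S (?R n)" "integrable S (\<lambda>y. ?g y + ?R n (shift y))"
      using integrable_running_max[OF assms, of n] g integrable_shift[of "?R n"] by auto
    fix y
    show "?R n y \<le> ?g y + ?R n (shift y)"
    proof (cases "?R n y > 0")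
      case True
      then have "?R n y = f (y 0) + ?R m (shift y)"
        by (auto simp: Suc shift_def max_def split: if_splits)
      also have "\<dots> \<le> f (y 0) + ?R n (shift y)"
        using running_max_mono by (simp add: Suc del: running_max.simps)
      finally show ?thesis using True by simp
    next
      case False
      then show ?thesis using running_max_nonneg[of n "\<lambda>i. f (shift y i)"] by simp
    qed
  qed
  also have "\<dots> = S.expectation ?g + S.expectation (?R n)"
    using g integrable_shift[OF integrable_running_max[OF assms, of n]] integral_shift[of "?R n"] by simp
  finally show ?thesis by simp
qed simp

text \<open>
  Otherwise the walk would be almost surely unbounded above, by the \<open>0\<close>-\<open>1\<close> law. Then the running
  maximum is eventually positive, and in the limit the maximal inequality states that the mean of
  a step is nonnegative.
\<close>
lemma walk_negative_drift_bdd_above: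
  assumes f_borel [measurable]: "f \<in> borel_measurable borel" and f: "integrable \<mu> f"
    and neg: "expectation f < 0"
  shows "AE y in S. bdd_above (range (walk (\<lambda>i. f (y i))))"
proof -
  let ?A = "{y. \<not> bdd_above (range (walk (\<lambda>i. f (y i))))}"
  let ?R = "\<lambda>n y. running_max n (\<lambda>i. f (y i))"
  have bdd_iff: "bdd_above (range (walk z)) \<longleftrightarrow> (\<exists>N::nat. \<forall>n. walk z n \<le> N)" for z
    by (auto simp: bdd_above_def) (meson order_trans real_arch_simple)
  have "{y \<in> space S. \<not> (\<exists>N::nat. \<forall>n. walk (\<lambda>i. f (y i)) n \<le> N)} \<in> sets S"
    by measurable
  then have A [measurable]: "?A \<in> sets S"
    by (simp add: bdd_iff)
  have "S.prob ?A = 0 \<or> S.prob ?A = 1"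
  proof (rule shift_invariant_0_1[OF A])
    fix y show "shift y \<in> ?A \<longleftrightarrow> y \<in> ?A"
      using bdd_above_walk_shift[of "\<lambda>i. f (y i)"] by (simp add: shift_def)
  qed
  moreover have "S.prob ?A \<noteq> 1"
  proof
    assume "S.prob ?A = 1"
    then have "AE y in S. y \<in> ?A"
      by (simp add: S.prob_eq_1)
    have [measurable]: "{y. ?R n y > 0} \<in> sets S" for n
      using borel_measurable_less[of "\<lambda>_. 0" S "?R n"] by simp
    \<comment> \<open>The events on which the running maximum is positive increase to the whole space.\<close>
    have "(\<lambda>n. S.expectation (\<lambda>y. f (y 0) * indicator {y. ?R n y > 0} y)) \<longlonglongrightarrow> S.expectation (\<lambda>y. f (y 0))"
    proof (rule integral_dominated_convergence)
      show "integrable S (\<lambda>y. \<bar>f (y 0)\<bar>)"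
        using integrable_coord[OF f_borel f, of 0] by simp
      show "AE y in S. (\<lambda>n. f (y 0) * indicator {y. ?R n y > 0} y) \<longlonglongrightarrow> f (y 0)"
        using \<open>AE y in S. y \<in> ?A\<close>
      proof eventually_elim
        case (elim y)
        then obtain n where "walk (\<lambda>i. f (y i)) n > 0"
          by (auto simp: bdd_above_def not_le)
        then have "?R n y > 0"
          using walk_le_running_max[of "\<lambda>i. f (y i)" n] by simp
        moreover have "?R n y \<le> ?R m y" if "n \<le> m" for m
          by (rule lift_Suc_mono_le[of "\<lambda>n. ?R n y", OF _ that]) (rule running_max_mono)
        ultimately have "?R m y > 0" if "n \<le> m" for m
          using that by (meson order_less_le_trans)
        then have "\<forall>\<^sub>F m in sequentially. f (y 0) * indicator {y. ?R m y > 0} y = f (y 0)"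
          by (auto intro!: eventually_sequentiallyI[of n])
        then show ?case by (rule tendsto_eventually)
      qed
    qed (auto simp: indicator_def)
    then have "0 \<le> S.expectation (\<lambda>y. f (y 0))"
      by (rule LIMSEQ_le_const) (use maximal_inequality[OF f_borel f] in blast)
    then show False
      using neg integral_coord[OF f_borel, of 0] by simp
  qed
  ultimately have "S.prob ?A = 0" by simp
  then show ?thesis
    using S.prob_eq_0[OF A] by simp
qed

end

context iid_sequence begin

text \<open>
  Both \<open>x - c\<close> and \<open>- x - c\<close> have negative mean for every \<open>c > 0\<close>, so the walk lies between two
  lines of arbitrarily small slope.
\<close>
lemma strong_law:
  assumes "integrable \<mu> (\<lambda>x. x)" and "expectation (\<lambda>x. x) = 0"
  shows "AE y in S. (\<lambda>n. walk y n / n) \<longlonglongrightarrow> 0"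
proof -
  have upper: "AE y in S. bdd_above (range (walk (\<lambda>i. y i - c)))" if "c > 0" for c
  proof -
    have "(\<lambda>x. x - c) \<in> borel_measurable borel" by measurable
    moreover have "integrable \<mu> (\<lambda>x. x - c)" using assms by simp
    moreover have "expectation (\<lambda>x. x - c) < 0" using assms that by simp
    ultimately show ?thesis by (rule walk_negative_drift_bdd_above)
  qed
  have lower: "AE y in S. bdd_above (range (walk (\<lambda>i. - y i - c)))" if "c > 0" for c
  proof -
    have "(\<lambda>x. - x - c) \<in> borel_measurable borel" by measurable
    moreover have "integrable \<mu> (\<lambda>x. - x - c)" using assms by simp
    moreover have "expectation (\<lambda>x. - x - c) < 0" using assms that by simp
    ultimately show ?thesis by (rule walk_negative_drift_bdd_above)
  qed
  have "AE y in S. \<forall>k::nat. bdd_above (range (walk (\<lambda>i. y i - 1 / Suc k)))"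
    unfolding AE_all_countable by (intro allI upper) simp
  moreover have "AE y in S. \<forall>k::nat. bdd_above (range (walk (\<lambda>i. - y i - 1 / Suc k)))"
    unfolding AE_all_countable by (intro allI lower) simp
  ultimately show ?thesis
  proof eventually_elim
    case (elim y)
    then show ?case
      using walk_sublinear_of_drifts[of y] by blast
  qed
qed

end

section \<open>Growth and increments of the centre of mass\<close>

lemma centre_Suc_shift: "centre y (Suc n) = y 0 + centre (shift y) n - centre (shift y) n / Suc n"
proof -
  have "(\<Sum>i=1..Suc n. walk y i) = (\<Sum>i\<le>n. walk y (Suc i))"
    by (simp only: One_nat_def sum.shift_bounds_cl_Suc_ivl atLeast0AtMost)
  also have "\<dots> = Suc n * y 0 + (\<Sum>i\<le>n. walk (shift y) i)"
    by (simp add: walk_Suc_shift sum.distrib algebra_simps)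
  also have "(\<Sum>i\<le>n. walk (shift y) i) = (\<Sum>i=1..n. walk (shift y) i)"
    by (rule sum.mono_neutral_right) (auto simp: Suc_le_eq)
  also have "\<dots> = n * centre (shift y) n"
    by (simp add: centre_def)
  finally have "centre y (Suc n) = (Suc n * y 0 + n * centre (shift y) n) / Suc n"
    unfolding centre_def[of y] by (rule arg_cong)
  then show ?thesis
    by (simp add: field_simps)
qed

lemma centre_Suc: "centre y (Suc n) = centre y n + (walk y (Suc n) - centre y n) / Suc n"
proof -
  have "Suc n * centre y (Suc n) = n * centre y n + walk y (Suc n)"
    by (simp add: centre_def)
  then show ?thesis by (simp add: field_simps)
qed

lemma centre_sublinear:
  assumes "(\<lambda>n. walk y n / n) \<longlonglongrightarrow> 0"
  shows "(\<lambda>n. centre y n / n) \<longlonglongrightarrow> 0"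
  unfolding sublinear_iff
proof (intro allI impI)
  fix e :: real assume "e > 0"
  then obtain C where C: "\<bar>walk y n\<bar> \<le> e * n + C" for n
    using assms unfolding sublinear_iff by blast
  have "\<bar>centre y n\<bar> \<le> e * n + C" for n
  proof (cases "n = 0")
    case True
    then show ?thesis using C[of 0] by (simp add: centre_def)
  next
    case False
    have "\<bar>\<Sum>i=1..n. walk y i\<bar> \<le> (\<Sum>i=1..n. e * n + C)"
    proof (rule order_trans[OF sum_abs sum_mono])
      fix i assume "i \<in> {1..n}"
      then have "e * i \<le> e * n" using \<open>e > 0\<close> by simp
      then show "\<bar>walk y i\<bar> \<le> e * n + C" using C[of i] by linarith
    qed
    then show ?thesis using False by (simp add: centre_def field_simps)
  qed
  then show "\<exists>C. \<forall>n. \<bar>centre y n\<bar> \<le> e * n + C" by blast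
qed

text \<open>
  This is what turns oscillation between \<open>-\<infinity>\<close> and \<open>\<infinity>\<close> into
  visits near every level.
\<close>
lemma centre_increments:
  assumes "(\<lambda>n. walk y n / n) \<longlonglongrightarrow> 0"
  shows "(\<lambda>n. centre y (Suc n) - centre y n) \<longlonglongrightarrow> 0"
proof -
  have "(\<lambda>n. walk y (Suc n) / Suc n - (centre y n / n) * (n / Suc n)) \<longlonglongrightarrow> 0 - 0 * 1"
    by (intro tendsto_intros LIMSEQ_Suc[OF assms] centre_sublinear[OF assms] LIMSEQ_n_over_Suc_n)
  also have "(\<lambda>n. walk y (Suc n) / Suc n - (centre y n / n) * (n / Suc n)) =
      (\<lambda>n. centre y (Suc n) - centre y n)"
    \<comment> \<open>At \<open>n = 0\<close> the equality relies on \<open>centre y 0 = 0\<close>, an instance of division by zero.\<close>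
    by (simp add: centre_Suc fun_eq_iff diff_divide_distrib) (simp add: centre_def)
  finally show ?thesis by simp
qed

section \<open>The upper limit of the centre of mass\<close>

definition limsup_centre :: "(nat \<Rightarrow> real) \<Rightarrow> ereal" where
  "limsup_centre y = limsup (\<lambda>n. ereal (centre y n))"

text \<open>
  The first step enters the centre with weight \<open>1\<close>, and the remaining discrepancy
  between \<open>centre y (Suc n)\<close> and \<open>centre (shift y) n\<close> vanishes because the centre grows sublinearly.
\<close>
lemma limsup_centre_shift:
  assumes "(\<lambda>n. walk y n / n) \<longlonglongrightarrow> 0"
  shows "limsup_centre y = ereal (y 0) + limsup_centre (shift y)"
proof -
  let ?z = "shift y"
  have "(\<lambda>n. centre ?z n / n) \<longlonglongrightarrow> 0"
    using assms by (intro centre_sublinear) (simp add: walk_sublinear_shift)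
  then have "(\<lambda>n. y 0 - (centre ?z n / n) * (n / Suc n)) \<longlonglongrightarrow> y 0 - 0 * 1"
    by (intro tendsto_intros LIMSEQ_n_over_Suc_n)
  moreover have "(centre ?z n / n) * (n / Suc n) = centre ?z n / Suc n" for n
    by (simp add: centre_def)
  ultimately have "(\<lambda>n. ereal (y 0 - centre ?z n / Suc n)) \<longlonglongrightarrow> ereal (y 0)"
    by simp
  then have "limsup (\<lambda>n. ereal (y 0 - centre ?z n / Suc n) + ereal (centre ?z n)) = ereal (y 0) + limsup_centre ?z"
    unfolding limsup_centre_def by (rule ereal_limsup_lim_add) simp
  moreover have "ereal (y 0 - centre ?z n / Suc n) + ereal (centre ?z n) = ereal (centre y (n + 1))" for n
    by (simp add: centre_Suc_shift)
  ultimately show ?thesis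
    using limsup_shift[of "\<lambda>n. ereal (centre y n)"] by (simp add: limsup_centre_def)
qed

text \<open>
  Since \<open>cos \<le> 1\<close>, the real part of the characteristic function can only be \<open>1\<close> at \<open>t\<close> if
  \<open>cos (t * x) = 1\<close> almost surely. Along a sequence of such \<open>t\<close> tending to \<open>0\<close>, a nonzero \<open>x\<close>
  eventually has \<open>t * x\<close> strictly between \<open>0\<close> and \<open>pi\<close> in absolute value, where \<open>cos < 1\<close>.
\<close>
lemma (in real_distribution) AE_eq_0_of_char_eq_1:
  assumes "d > 0" and char: "\<And>t. \<bar>t\<bar> < d \<Longrightarrow> char M t = 1"
  shows "AE x in M. x = 0"
proof -
  have cos_1: "AE x in M. cos (t * x) = 1" if "\<bar>t\<bar> < d" for t
  proof -
    have "expectation (\<lambda>x. cos (t * x)) = Re (char M t)"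
      unfolding char_def by (subst integral_Re[symmetric]) (auto intro: integrable_iexp simp: Re_exp)
    then have "expectation (\<lambda>x. cos (t * x)) = 1"
      using char[OF that] by simp
    moreover have int: "integrable M (\<lambda>x. cos (t * x))"
      by (rule integrable_const_bound[of _ 1]) auto
    ultimately have "expectation (\<lambda>x. 1 - cos (t * x)) = 0"
      using prob_space by simp
    then have "AE x in M. 1 - cos (t * x) = 0"
      by (subst (asm) integral_nonneg_eq_0_iff_AE) (use int in auto)
    then show ?thesis by simp
  qed
  have "AE x in M. \<forall>k::nat. cos (d / (k + 2) * x) = 1"
    unfolding AE_all_countable using \<open>d > 0\<close> by (intro allI cos_1) (simp add: field_simps add_pos_nonneg)
  then show ?thesis
  proof eventually_elim
    case (elim x)
    show "x = 0"
    proof (rule ccontr)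
      assume "x \<noteq> 0"
      obtain k :: nat where k: "d * \<bar>x\<bar> < k"
        using reals_Archimedean2 by blast
      let ?u = "d / (k + 2) * \<bar>x\<bar>"
      have "0 < ?u" using \<open>d > 0\<close> \<open>x \<noteq> 0\<close> by simp
      moreover have "?u \<le> 1" using k by (simp add: field_simps)
      then have "?u \<le> pi" using pi_ge_two by linarith
      ultimately have "cos ?u < cos 0"
        by (intro cos_monotone_0_pi) auto
      moreover have "cos ?u = cos (d / (k + 2) * x)"
        by (cases "x \<ge> 0") auto
      ultimately show False using spec[OF elim, of k] by (simp add: add.commute)
    qed
  qed
qed

context iid_sequence begin

text \<open>
  Fubini's theorem for a sequence seen as its first term followed by an independent sequence.
\<close>
lemma integral_split:
  fixes g :: "(nat \<Rightarrow> real) \<Rightarrow> complex"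
  assumes [measurable]: "g \<in> borel_measurable S" and bound: "\<And>y. norm (g y) \<le> 1"
  shows "(CLINT y|S. g y) = (CLINT x|\<mu>. CLINT y|S. g (case_nat x y))"
proof -
  interpret P: pair_prob_space \<mu> S by unfold_locales
  have "(CLINT y|S. g y) = (CLINT y|distr (\<mu> \<Otimes>\<^sub>M S) S (\<lambda>(x, y). case_nat x y). g y)"
    by (simp add: S_split)
  also have "\<dots> = (CLINT p|\<mu> \<Otimes>\<^sub>M S. g (case_nat (fst p) (snd p)))"
    by (subst integral_distr) (auto simp: split_beta')
  also have "\<dots> = (CLINT x|\<mu>. CLINT y|S. g (case_nat x y))"
  proof (subst P.integral_fst'[symmetric])
    have "(\<lambda>p. g (case_nat (fst p) (snd p))) \<in> borel_measurable (\<mu> \<Otimes>\<^sub>M S)"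
      by measurable
    then show "integrable (\<mu> \<Otimes>\<^sub>M S) (\<lambda>p. g (case_nat (fst p) (snd p)))"
      by (intro P.integrable_const_bound[of _ 1]) (auto simp: bound)
  qed simp
  finally show ?thesis .
qed

lemma measurable_centre [measurable]: "(\<lambda>y. centre y n) \<in> borel_measurable S"
  unfolding centre_def walk_def by measurable

lemma measurable_limsup_centre [measurable]: "limsup_centre \<in> borel_measurable S"
  unfolding limsup_centre_def by measurable

text \<open>
  The step is independent of \<open>R (shift y)\<close>, and the latter has the law of \<open>R\<close>. So the characteristic
  function of \<open>R\<close> equals itself times that of \<open>\<mu>\<close>. As it is nonzero near \<open>0\<close>, the characteristic
  function of \<open>\<mu>\<close> is \<open>1\<close> there.
\<close>
lemma shift_cocycle_trivial:
  assumes [measurable]: "R \<in> borel_measurable S"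
    and R: "AE y in S. R y = y 0 + R (shift y)"
  shows "AE x in \<mu>. x = 0"
proof -
  let ?\<phi> = "char (distr S borel R)"
  interpret R: real_distribution "distr S borel R" by (rule S.real_distribution_distr) simp
  have factor: "?\<phi> t = char \<mu> t * ?\<phi> t" for t
  proof -
    have "?\<phi> t = (CLINT y|S. iexp (t * R y))"
      by (simp add: char_def integral_distr)
    also have "\<dots> = (CLINT y|S. iexp (t * (y 0 + R (shift y))))"
    proof (rule integral_cong_AE)
      show "AE y in S. iexp (t * R y) = iexp (t * (y 0 + R (shift y)))"
        using R by eventually_elim simp
    qed measurable
    also have "\<dots> = (CLINT x|\<mu>. CLINT y|S. iexp (t * (x + R y)))"
    proof (subst integral_split)
      show "(\<lambda>y. iexp (t * (y 0 + R (shift y)))) \<in> borel_measurable S"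
        by measurable
    qed (simp_all add: shift_def)
    also have "\<dots> = (CLINT x|\<mu>. iexp (t * x) * (CLINT y|S. iexp (t * R y)))"
      by (subst integral_mult_right_zero[symmetric]) (simp add: algebra_simps exp_add)
    also have "\<dots> = (CLINT x|\<mu>. iexp (t * x)) * (CLINT y|S. iexp (t * R y))"
      by (rule integral_mult_left_zero)
    also have "\<dots> = char \<mu> t * ?\<phi> t"
      by (simp add: char_def integral_distr)
    finally show ?thesis .
  qed
  have "isCont ?\<phi> 0" by (rule R.isCont_char)
  then obtain d where "d > 0" and d: "\<And>t. \<bar>t\<bar> < d \<Longrightarrow> dist (?\<phi> t) (?\<phi> 0) < 1"
    unfolding continuous_at_eps_delta by (metis diff_zero dist_real_def zero_less_one)
  have "char \<mu> t = 1" if "\<bar>t\<bar> < d" for t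
  proof -
    have "?\<phi> t \<noteq> 0"
      using d[OF that] by (auto simp: R.char_zero)
    then show ?thesis using factor[of t] by simp
  qed
  with \<open>d > 0\<close> show ?thesis by (rule AE_eq_0_of_char_eq_1)
qed

text \<open>
  Each infinite value of the upper limit is attained with probability \<open>0\<close> or \<open>1\<close>. If neither were
  attained, the real-valued upper limit would be a cocycle as in \<open>shift_cocycle_trivial\<close>.
\<close>
lemma limsup_centre_infinite:
  assumes "integrable \<mu> (\<lambda>x. x)" and "expectation (\<lambda>x. x) = 0"
    and nondegenerate: "\<not> (AE x in \<mu>. x = 0)"
  shows "(AE y in S. limsup_centre y = \<infinity>) \<or> (AE y in S. limsup_centre y = -\<infinity>)"
proof -
  let ?E = "\<lambda>y. (\<lambda>n. walk y n / n) \<longlonglongrightarrow> 0"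
  have E: "AE y in S. ?E y"
    using strong_law[OF assms(1,2)] .
  have [measurable]: "(\<lambda>y. walk y n) \<in> borel_measurable S" for n
    unfolding walk_def by measurable
  have zero_one: "(AE y in S. limsup_centre y = a) \<or> (AE y in S. limsup_centre y \<noteq> a)"
    if "\<bar>a\<bar> = \<infinity>" for a
  proof -
    \<comment> \<open>The shift equation for the upper limit holds only where the walk is sublinear. Including
      this event of full measure makes the invariance exact.\<close>
    let ?A = "{y. ?E y \<and> limsup_centre y = a}"
    have "{y \<in> space S. ?E y \<and> limsup_centre y = a} \<in> sets S"
      by measurable
    then have A: "?A \<in> sets S" by simp
    then have "S.prob ?A = 0 \<or> S.prob ?A = 1"
    proof (rule shift_invariant_0_1)
      show "shift y \<in> ?A \<longleftrightarrow> y \<in> ?A" for y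
      proof (cases "?E y")
        case True
        then show ?thesis
          using limsup_centre_shift[OF True] that
          by (cases "limsup_centre (shift y)"; cases a) (auto simp: walk_sublinear_shift)
      qed (simp add: walk_sublinear_shift)
    qed
    then have "(AE y in S. y \<in> ?A) \<or> (AE y in S. y \<notin> ?A)"
      using S.prob_eq_0[OF A] S.prob_eq_1[OF A] by blast
    then show ?thesis
    proof
      assume "AE y in S. y \<in> ?A"
      then have "AE y in S. limsup_centre y = a" by eventually_elim simp
      then show ?thesis ..
    next
      assume "AE y in S. y \<notin> ?A"
      with E have "AE y in S. limsup_centre y \<noteq> a" by eventually_elim simp
      then show ?thesis ..
    qed
  qed
  have "\<not> ((AE y in S. limsup_centre y \<noteq> \<infinity>) \<and> (AE y in S. limsup_centre y \<noteq> -\<infinity>))"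
  proof
    assume "(AE y in S. limsup_centre y \<noteq> \<infinity>) \<and> (AE y in S. limsup_centre y \<noteq> -\<infinity>)"
    then have "AE y in S. limsup_centre y \<noteq> \<infinity>" "AE y in S. limsup_centre y \<noteq> -\<infinity>"
      by simp_all
    with E have "AE y in S. real_of_ereal (limsup_centre y) = y 0 + real_of_ereal (limsup_centre (shift y))"
    proof eventually_elim
      case (elim y)
      then show ?case
        using limsup_centre_shift[of y] by (cases "limsup_centre (shift y)") auto
    qed
    then have "AE x in \<mu>. x = 0"
      by (rule shift_cocycle_trivial[rotated]) measurable
    then show False using nondegenerate by contradiction
  qed
  then show ?thesis
    using zero_one[of \<infinity>] zero_one[of "-\<infinity>"] by (metis abs_ereal.simps(2,3) uminus_ereal.simps(2))
qed

end

section \<open>Steps with finite variance\<close>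

text \<open>
  The position \<open>walk y j\<close> contains the step \<open>y i\<close> exactly when \<open>i < j\<close>, so \<open>y i\<close> occurs in
  \<open>n - i\<close> of the \<open>n\<close> positions averaged in \<open>centre y n\<close>.
\<close>
definition weight :: "nat \<Rightarrow> nat \<Rightarrow> real" where
  "weight n i = (real n - real i) / real n"

lemma centre_weighted: "centre y n = (\<Sum>i<n. weight n i * y i)"
proof -
  have "(\<Sum>i=1..n. walk y i) = (\<Sum>i<n. (real n - real i) * y i)"
  proof (induction n)
    case (Suc n)
    have "(\<Sum>i<Suc n. (real (Suc n) - real i) * y i) =
        (\<Sum>i<Suc n. (real n - real i) * y i) + (\<Sum>i<Suc n. y i)"
      unfolding sum.distrib[symmetric] by (intro sum.cong) (auto simp: algebra_simps)
    then show ?case using Suc by (simp add: walk_def)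
  qed simp
  then show ?thesis
    by (simp add: centre_def weight_def sum_divide_distrib)
qed

lemma weight_bounds: "i < n \<Longrightarrow> 0 \<le> weight n i" "i < n \<Longrightarrow> weight n i \<le> 1"
  by (auto simp: weight_def)

text \<open>
  From \<open>(w - 1/2)\<^sup>2 \<ge> 0\<close> each squared weight is at least \<open>w - 1/4\<close>, and the weights sum
  to \<open>(n + 1) / 2\<close>.
\<close>
lemma sum_weight_power2_ge: "(\<Sum>i<n. (weight n i)\<^sup>2) \<ge> n / 4"
proof (cases "n = 0")
  case False
  have "2 * (\<Sum>i<n. real n - real i) = real n * (real n + 1)"
    by (induction n) (simp_all add: sum.distrib sum_subtractf algebra_simps)
  then have "(\<Sum>i<n. weight n i) = (real n + 1) / 2"
    using False by (simp add: weight_def sum_divide_distrib[symmetric] field_simps)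
  moreover have "(\<Sum>i<n. weight n i - 1 / 4) \<le> (\<Sum>i<n. (weight n i)\<^sup>2)"
  proof (rule sum_mono)
    fix i
    have "0 \<le> (weight n i - 1 / 2)\<^sup>2" by simp
    then show "weight n i - 1 / 4 \<le> (weight n i)\<^sup>2"
      by (simp add: power2_eq_square algebra_simps)
  qed
  ultimately show ?thesis by (simp add: sum_subtractf)
qed simp

locale square_integrable_iid_sequence = iid_sequence +
  assumes square_integrable: "integrable \<mu> (\<lambda>x. x\<^sup>2)"
    and mean_0: "expectation (\<lambda>x. x) = 0"
    and second_moment_pos: "expectation (\<lambda>x. x\<^sup>2) > 0"
begin

abbreviation v :: real where "v \<equiv> expectation (\<lambda>x. x\<^sup>2)"

lemma integrable_id: "integrable \<mu> (\<lambda>x. x)"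
  by (rule square_integrable_imp_integrable[OF _ square_integrable]) simp

lemma integrable_coord_id: "integrable S (\<lambda>y. y i)"
  by (rule integrable_coord[of "\<lambda>x. x", OF _ integrable_id]) simp

lemma integrable_centre: "integrable S (\<lambda>y. centre y n)"
  unfolding centre_weighted by (intro Bochner_Integration.integrable_sum integrable_mult_right integrable_coord_id)

lemma expectation_coord: "S.expectation (\<lambda>y. y i) = 0"
  using integral_coord[of "\<lambda>x. x" i] mean_0 by simp

lemma expectation_centre: "S.expectation (\<lambda>y. centre y n) = 0"
  unfolding centre_weighted
  by (subst Bochner_Integration.integral_sum)
     (simp_all add: integrable_coord_id expectation_coord)

lemma product_moment:
  "integrable S (\<lambda>y. y i * y j)" "S.expectation (\<lambda>y. y i * y j) = (if i = j then v else 0)"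
proof -
  have "integrable S (\<lambda>y. y i * y j) \<and> S.expectation (\<lambda>y. y i * y j) = (if i = j then v else 0)"
  proof (cases "i = j")
    case True
    then show ?thesis
      using integrable_coord[of "\<lambda>x. x\<^sup>2" i, OF _ square_integrable] integral_coord[of "\<lambda>x. x\<^sup>2" i]
      by (simp add: power2_eq_square)
  next
    case False
    then have prod: "(\<Prod>k\<in>{i, j}. y k) = y i * y j" for y :: "nat \<Rightarrow> real"
      by simp
    have "S.indep_vars (\<lambda>_. borel) (\<lambda>k y. y k) {i, j}"
      using indep_coords by (rule S.indep_vars_subset) simp
    then show ?thesis
      using S.indep_vars_integrable[of "{i, j}" "\<lambda>k y. y k"]
        S.indep_vars_lebesgue_integral[of "{i, j}" "\<lambda>k y. y k"] False
      unfolding prod by (simp add: integrable_coord_id expectation_coord)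
  qed
  then show "integrable S (\<lambda>y. y i * y j)" "S.expectation (\<lambda>y. y i * y j) = (if i = j then v else 0)"
    by auto
qed

text \<open>
  Distinct steps are uncorrelated, so only the diagonal contributes, with weights at most \<open>1\<close>.
\<close>
lemma second_moment_centre:
  "integrable S (\<lambda>y. (centre y n)\<^sup>2)" "S.expectation (\<lambda>y. (centre y n)\<^sup>2) \<le> n * v"
proof -
  have sq: "(centre y n)\<^sup>2 = (\<Sum>i<n. \<Sum>j<n. weight n i * weight n j * (y i * y j))" for y
    unfolding centre_weighted power2_eq_square sum_product by (intro sum.cong) (auto simp: algebra_simps)
  show "integrable S (\<lambda>y. (centre y n)\<^sup>2)"
    unfolding sq by (intro Bochner_Integration.integrable_sum integrable_mult_right product_moment)
  have "S.expectation (\<lambda>y. (centre y n)\<^sup>2) = (\<Sum>i<n. \<Sum>j<n. weight n i * weight n j * (if i = j then v else 0))"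
    unfolding sq
    by (simp add: Bochner_Integration.integral_sum product_moment Bochner_Integration.integrable_sum)
  also have "\<dots> = (\<Sum>i<n. (weight n i)\<^sup>2 * v)"
    by (intro sum.cong refl) (simp add: power2_eq_square if_distrib sum.delta cong: if_cong)
  also have "\<dots> \<le> (\<Sum>i<n. 1 * v)"
    using second_moment_pos
    by (intro sum_mono mult_right_mono) (auto simp: weight_bounds power_le_one)
  finally show "S.expectation (\<lambda>y. (centre y n)\<^sup>2) \<le> n * v" by simp
qed

lemma char_centre:
  "char (distr S borel (\<lambda>y. centre y n / sqrt n)) 1 = (\<Prod>i<n. char \<mu> (weight n i / sqrt n))"
proof -
  have "char (distr S borel (\<lambda>y. centre y n / sqrt n)) 1 =
      char (distr S borel (\<lambda>y. \<Sum>i<n. weight n i / sqrt n * y i)) 1"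
    by (simp add: centre_weighted sum_divide_distrib)
  also have "\<dots> = (\<Prod>i<n. char (distr S borel (\<lambda>y. weight n i / sqrt n * y i)) 1)"
    by (intro S.char_distr_sum S.indep_vars_compose2[OF S.indep_vars_subset[OF indep_coords]]) auto
  also have "\<dots> = (\<Prod>i<n. char \<mu> (weight n i / sqrt n))"
  proof (rule prod.cong[OF refl])
    fix i
    have "char (distr S borel (\<lambda>y. weight n i / sqrt n * y i)) 1 =
        char (distr S borel (\<lambda>y. y i)) (weight n i / sqrt n)"
      by (simp add: char_def integral_distr)
    then show "char (distr S borel (\<lambda>y. weight n i / sqrt n * y i)) 1 = char \<mu> (weight n i / sqrt n)"
      by (simp add: distr_coord)
  qed
  finally show ?thesis .
qed

text \<open>
  The second-order expansion \<open>1 - t\<^sup>2 * v / 2\<close> of the characteristic function, with an error of at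
  most \<open>t\<^sup>2 * v / 6\<close> by the second assumption.
\<close>
lemma cmod_char_le:
  assumes "t\<^sup>2 * v \<le> 2" and small: "expectation (\<lambda>x. min (6 * x\<^sup>2) (\<bar>t\<bar> * \<bar>x\<bar> ^ 3)) \<le> v"
  shows "cmod (char \<mu> t) \<le> exp (- (t\<^sup>2 * v / 3))"
proof -
  have "cmod (char \<mu> t - (1 - t\<^sup>2 * v / 2)) \<le> t\<^sup>2 / 6 * expectation (\<lambda>x. min (6 * x\<^sup>2) (\<bar>t\<bar> * \<bar>x\<bar> ^ 3))"
    using char_approx3[OF integrable_id mean_0 square_integrable, of v t] mean_0 by simp
  also have "\<dots> \<le> t\<^sup>2 / 6 * v"
    using small by (intro mult_left_mono) auto
  finally have "cmod (char \<mu> t) \<le> cmod (of_real (1 - t\<^sup>2 * v / 2)) + t\<^sup>2 / 6 * v"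
    using norm_triangle_sub[of "char \<mu> t" "of_real (1 - t\<^sup>2 * v / 2)"] by simp
  also have "\<dots> = 1 - t\<^sup>2 * v / 3"
    using assms(1) by (subst norm_of_real) simp
  also have "\<dots> \<le> exp (- (t\<^sup>2 * v / 3))"
    using exp_ge_add_one_self[of "- (t\<^sup>2 * v / 3)"] by simp
  finally show ?thesis .
qed

text \<open>
  Every argument \<open>weight n i / sqrt n\<close> is at most \<open>1 / sqrt n\<close>, so for large \<open>n\<close> the estimate
  \<open>cmod_char_le\<close> holds for all factors of \<open>char_centre\<close> at once. Their product is governed by the
  sum of the squared weights, which is at least \<open>n / 4\<close>.
\<close>
lemma cmod_char_centre_bounded:
  "\<forall>\<^sub>F n in sequentially. cmod (char (distr S borel (\<lambda>y. centre y n / sqrt n)) 1) \<le> exp (- (v / 12))"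
proof -
  let ?K = "\<lambda>s. expectation (\<lambda>x. min (6 * x\<^sup>2) (s * \<bar>x\<bar> ^ 3))"
  have int: "integrable \<mu> (\<lambda>x. min (6 * x\<^sup>2) (s * \<bar>x\<bar> ^ 3))" if "s \<ge> 0" for s
    by (rule Bochner_Integration.integrable_bound[of \<mu> "\<lambda>x. 6 * x\<^sup>2"]) (use square_integrable that in auto)
  have "(\<lambda>n. ?K (1 / sqrt n)) \<longlonglongrightarrow> expectation (\<lambda>x. 0)"
  proof (rule integral_dominated_convergence)
    show "integrable \<mu> (\<lambda>x. 6 * x\<^sup>2)" using square_integrable by simp
    show "AE x in \<mu>. (\<lambda>n. min (6 * x\<^sup>2) (1 / sqrt (real n) * \<bar>x\<bar> ^ 3)) \<longlonglongrightarrow> 0"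
    proof (rule AE_I2)
      fix x :: real
      have "(\<lambda>n. 1 / sqrt (real n)) \<longlonglongrightarrow> 0" by real_asymp
      then have "(\<lambda>n. min (6 * x\<^sup>2) (1 / sqrt (real n) * \<bar>x\<bar> ^ 3)) \<longlonglongrightarrow> min (6 * x\<^sup>2) (0 * \<bar>x\<bar> ^ 3)"
        by (intro tendsto_intros)
      then show "(\<lambda>n. min (6 * x\<^sup>2) (1 / sqrt (real n) * \<bar>x\<bar> ^ 3)) \<longlonglongrightarrow> 0"
        by simp
    qed
  qed auto
  then have "\<forall>\<^sub>F n in sequentially. ?K (1 / sqrt n) < v"
    using second_moment_pos by (intro order_tendstoD(2)) simp_all
  moreover have "\<forall>\<^sub>F n in sequentially. real n > v"
    using filterlim_real_sequentially by (simp add: filterlim_at_top_dense)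
  ultimately show ?thesis
  proof eventually_elim
    case (elim n)
    then have "n > 0" using second_moment_pos by simp
    have "cmod (char \<mu> (weight n i / sqrt n)) \<le> exp (- ((weight n i)\<^sup>2 * (v / (3 * n))))" if "i < n" for i
    proof -
      let ?t = "weight n i / sqrt n"
      have w: "0 \<le> weight n i" "weight n i \<le> 1"
        using weight_bounds[OF that] by auto
      have t: "0 \<le> ?t" "?t \<le> 1 / sqrt n" "?t\<^sup>2 = (weight n i)\<^sup>2 / n"
        using w by (auto simp: power_divide divide_right_mono)
      have "(weight n i)\<^sup>2 * v \<le> 1 * v"
        using w second_moment_pos by (intro mult_right_mono) (auto simp: power_le_one)
      then have "?t\<^sup>2 * v \<le> 2"
        using elim(2) \<open>n > 0\<close> by (simp add: t field_simps)
      moreover have "?K \<bar>?t\<bar> \<le> ?K (1 / sqrt n)"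
      proof (rule integral_mono)
        show "min (6 * x\<^sup>2) (\<bar>?t\<bar> * \<bar>x\<bar> ^ 3) \<le> min (6 * x\<^sup>2) (1 / sqrt n * \<bar>x\<bar> ^ 3)" for x
          using t by (intro min.mono mult_right_mono) auto
      qed (rule int, simp)+
      ultimately have "cmod (char \<mu> ?t) \<le> exp (- (?t\<^sup>2 * v / 3))"
        using elim(1) by (intro cmod_char_le) auto
      also have "?t\<^sup>2 * v / 3 = (weight n i)\<^sup>2 * (v / (3 * n))"
        by (simp add: t)
      finally show ?thesis .
    qed
    then have "cmod (\<Prod>i<n. char \<mu> (weight n i / sqrt n)) \<le> (\<Prod>i<n. exp (- ((weight n i)\<^sup>2 * (v / (3 * n)))))"
      unfolding prod_norm[symmetric] by (intro prod_mono) auto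
    also have "\<dots> = exp (- ((\<Sum>i<n. (weight n i)\<^sup>2) * (v / (3 * n))))"
      by (simp only: exp_sum[symmetric] finite_lessThan sum_negf sum_distrib_right)
    also have "\<dots> \<le> exp (- (n / 4 * (v / (3 * n))))"
      using sum_weight_power2_ge[of n] second_moment_pos
      by (subst exp_le_cancel_iff, subst neg_le_iff_le, intro mult_right_mono) auto
    also have "n / 4 * (v / (3 * n)) = v / 12"
      using \<open>n > 0\<close> by simp
    finally show ?case by (simp add: char_centre)
  qed
qed

lemma cmod_1_minus_char_centre:
  "cmod (1 - char (distr S borel (\<lambda>y. centre y n / sqrt n)) 1) \<le> S.expectation (\<lambda>y. \<bar>centre y n\<bar>) / sqrt n"
proof -
  let ?u = "\<lambda>y. centre y n / sqrt n"
  have int: "integrable S (\<lambda>y. iexp (?u y))"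
    by (rule S.integrable_iexp) (simp_all only: Im_complex_of_real, measurable)
  have "1 - char (distr S borel ?u) 1 = (CLINT y|S. 1 - iexp (?u y))"
    using int by (simp add: char_def integral_distr S_prob_UNIV)
  also have "cmod \<dots> \<le> S.expectation (\<lambda>y. cmod (1 - iexp (?u y)))"
    by (rule integral_norm_bound)
  also have "\<dots> \<le> S.expectation (\<lambda>y. \<bar>centre y n\<bar> / sqrt n)"
  proof (rule integral_mono)
    show "integrable S (\<lambda>y. cmod (1 - iexp (?u y)))"
      using int by (intro integrable_norm) auto
    show "integrable S (\<lambda>y. \<bar>centre y n\<bar> / sqrt n)"
      using integrable_centre by (intro integrable_divide) auto
    show "cmod (1 - iexp (?u y)) \<le> \<bar>centre y n\<bar> / sqrt n" for y
      using iexp_approx1[of "?u y" 0] by (simp add: norm_minus_commute)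
  qed
  finally show ?thesis by simp
qed

text \<open>
  As the centre has mean \<open>0\<close>, its absolute moment is twice that of its positive part. The positive
  part is split between the second moment and the probability of being positive by
  the inequality of arithmetic and geometric means, where \<open>\<eta>\<close> is the balance between the two.
\<close>
lemma abs_moment_centre_le:
  assumes "\<eta> > 0" "n > 0"
  shows "S.expectation (\<lambda>y. \<bar>centre y n\<bar>) / sqrt n \<le> 2 * \<eta> * v + S.prob {y. centre y n > 0} / (2 * \<eta>)"
proof -
  let ?c = "\<lambda>y. centre y n" and ?P = "{y. centre y n > 0}"
  have [measurable]: "?P \<in> sets S"
    using borel_measurable_less[of "\<lambda>_. 0" S ?c] by simp
  have bound: "\<bar>?c y\<bar> \<le> 2 * \<eta> / sqrt n * (?c y)\<^sup>2 + sqrt n / (2 * \<eta>) * indicator ?P y - ?c y" for y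
  proof (cases "?c y > 0")
    case True
    have "0 \<le> (2 * \<eta> * ?c y - sqrt n)\<^sup>2" by simp
    then have "4 * \<eta> * ?c y * sqrt n \<le> 4 * \<eta>\<^sup>2 * (?c y)\<^sup>2 + (sqrt n)\<^sup>2"
      by (simp add: power2_eq_square algebra_simps)
    then have "2 * ?c y \<le> (4 * \<eta>\<^sup>2 * (?c y)\<^sup>2 + (sqrt n)\<^sup>2) / (2 * \<eta> * sqrt n)"
      using assms by (simp add: pos_le_divide_eq algebra_simps)
    also have "\<dots> = 2 * \<eta> / sqrt n * (?c y)\<^sup>2 + sqrt n / (2 * \<eta>)"
      using assms by (simp add: power2_eq_square field_simps del: real_sqrt_mult_self)
    finally show ?thesis using True by simp
  next
    case False
    then show ?thesis using assms by simp
  qed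
  have "S.expectation (\<lambda>y. \<bar>?c y\<bar>) \<le>
      S.expectation (\<lambda>y. 2 * \<eta> / sqrt n * (?c y)\<^sup>2 + sqrt n / (2 * \<eta>) * indicator ?P y - ?c y)"
    using bound integrable_centre second_moment_centre(1)
    by (intro integral_mono) (auto simp: S.emeasure_eq_measure)
  also have "\<dots> = 2 * \<eta> / sqrt n * S.expectation (\<lambda>y. (?c y)\<^sup>2) + sqrt n / (2 * \<eta>) * S.prob ?P"
    using integrable_centre[of n] second_moment_centre(1)[of n]
    by (simp add: expectation_centre S.emeasure_eq_measure)
  also have "\<dots> \<le> 2 * \<eta> / sqrt n * (n * v) + sqrt n / (2 * \<eta>) * S.prob ?P"
    using assms second_moment_centre(2) by (intro add_right_mono mult_left_mono) auto
  also have "\<dots> = sqrt n * (2 * \<eta> * v + S.prob ?P / (2 * \<eta>))"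
  proof -
    have "real n / sqrt n = sqrt n" by (rule real_div_sqrt) simp
    then have "2 * \<eta> / sqrt n * (n * v) = sqrt n * (2 * \<eta> * v)"
      by (simp add: mult.assoc flip: times_divide_eq_left) (simp add: mult_ac divide_inverse)
    then show ?thesis by (simp add: algebra_simps)
  qed
  finally show ?thesis
    using assms by (simp add: pos_divide_le_eq mult.commute)
qed

text \<open>
  If the centre tended to \<open>-\<infinity>\<close>, the bound of \<open>abs_moment_centre_le\<close> could be made smaller
  than any positive number, and then so could the distance of the characteristic function from \<open>1\<close>.
  This contradicts \<open>cmod_char_centre_bounded\<close>.
\<close>
lemma limsup_centre_not_minus_infinity: "\<not> (AE y in S. limsup_centre y = -\<infinity>)"
proof
  assume minus_infinity: "AE y in S. limsup_centre y = -\<infinity>"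
  let ?P = "\<lambda>n. {y. centre y n > 0}"
  have [measurable]: "?P n \<in> sets S" for n
    using borel_measurable_less[of "\<lambda>_. 0" S "\<lambda>y. centre y n"] by simp
  have "(\<lambda>n. S.expectation (indicator (?P n) :: _ \<Rightarrow> real)) \<longlonglongrightarrow> S.expectation (\<lambda>_. 0)"
  proof (rule integral_dominated_convergence)
    show "AE y in S. (\<lambda>n. indicator (?P n) y :: real) \<longlonglongrightarrow> 0"
      using minus_infinity
    proof eventually_elim
      case (elim y)
      then have "limsup (\<lambda>n. ereal (centre y n)) < 0"
        by (simp add: limsup_centre_def)
      then have "\<forall>\<^sub>F n in sequentially. ereal (centre y n) < 0"
        by (rule Limsup_lessD)
      then have "\<forall>\<^sub>F n in sequentially. indicator (?P n) y = (0::real)"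
        by eventually_elim (simp add: zero_ereal_def)
      then show ?case by (rule tendsto_eventually)
    qed
    show "integrable S (\<lambda>_. 1 :: real)" by simp
  qed (auto simp: indicator_def)
  then have P: "(\<lambda>n. S.prob (?P n)) \<longlonglongrightarrow> 0" by simp
  define \<epsilon> where "\<epsilon> = 1 - exp (- (v / 12))"
  have "\<epsilon> > 0" using second_moment_pos by (simp add: \<epsilon>_def)
  \<comment> \<open>This choice makes the second-moment term \<open>2 * \<eta> * v\<close> equal to \<open>\<epsilon> / 2\<close>.\<close>
  define \<eta> where "\<eta> = \<epsilon> / (4 * v)"
  have "\<eta> > 0" using \<open>\<epsilon> > 0\<close> second_moment_pos by (simp add: \<eta>_def)
  have "\<forall>\<^sub>F n in sequentially. S.prob (?P n) < \<epsilon> * \<eta>"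
    using order_tendstoD(2)[OF P] \<open>\<epsilon> > 0\<close> \<open>\<eta> > 0\<close> by (meson mult_pos_pos)
  then have "\<forall>\<^sub>F n in sequentially. False"
    using cmod_char_centre_bounded eventually_gt_at_top[of 0]
  proof eventually_elim
    case (elim n)
    let ?\<phi> = "char (distr S borel (\<lambda>y. centre y n / sqrt n)) 1"
    have "cmod (1 - ?\<phi>) \<le> 2 * \<eta> * v + S.prob (?P n) / (2 * \<eta>)"
      using cmod_1_minus_char_centre[of n] abs_moment_centre_le[OF \<open>\<eta> > 0\<close> elim(3)] by linarith
    also have "\<dots> < 2 * \<eta> * v + \<epsilon> * \<eta> / (2 * \<eta>)"
      using elim(1) \<open>\<eta> > 0\<close> by (intro add_strict_left_mono divide_strict_right_mono) auto
    also have "\<dots> = \<epsilon>"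
      using \<open>\<eta> > 0\<close> second_moment_pos by (simp add: \<eta>_def field_simps)
    finally have "cmod (1 - ?\<phi>) < 1 - exp (- (v / 12))" by (simp add: \<epsilon>_def)
    moreover have "1 \<le> cmod (1 - ?\<phi>) + cmod ?\<phi>"
      using norm_triangle_sub[of "1::complex" ?\<phi>] by simp
    ultimately show False using elim(2) by linarith
  qed
  then show False by simp
qed

end

section \<open>Oscillation and reflection\<close>

text \<open>
  A sequence that eventually keeps a distance \<open>e\<close> from \<open>x\<close> while its steps are shorter than \<open>e\<close>
  cannot cross \<open>x\<close>. Once below \<open>x\<close> it stays there, and its upper limit is at most \<open>x\<close>.
\<close>
lemma liminf_dist_eq_0_of_oscillation:
  fixes g :: "nat \<Rightarrow> real"
  assumes limsup: "limsup (\<lambda>n. ereal (g n)) = \<infinity>" and liminf: "liminf (\<lambda>n. ereal (g n)) = -\<infinity>"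
    and steps: "(\<lambda>n. g (Suc n) - g n) \<longlonglongrightarrow> 0"
  shows "liminf (\<lambda>n. ereal \<bar>g n - x\<bar>) = 0"
proof (rule antisym)
  show "0 \<le> liminf (\<lambda>n. ereal \<bar>g n - x\<bar>)"
    by (rule Liminf_bounded) simp
  show "liminf (\<lambda>n. ereal \<bar>g n - x\<bar>) \<le> 0"
  proof (rule ccontr)
    assume "\<not> liminf (\<lambda>n. ereal \<bar>g n - x\<bar>) \<le> 0"
    then have "0 < liminf (\<lambda>n. ereal \<bar>g n - x\<bar>)" by (simp add: not_le)
    then obtain e where e: "0 < ereal e" "ereal e < liminf (\<lambda>n. ereal \<bar>g n - x\<bar>)"
      using ereal_dense2 by blast
    have "\<forall>\<^sub>F n in sequentially. ereal e < ereal \<bar>g n - x\<bar>"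
      using e(2) by (rule less_LiminfD)
    moreover have "\<forall>\<^sub>F n in sequentially. \<bar>g (Suc n) - g n\<bar> < e"
      using tendstoD[OF steps, of e] e(1) by (simp add: dist_real_def)
    ultimately have "\<forall>\<^sub>F n in sequentially. e < \<bar>g n - x\<bar> \<and> \<bar>g (Suc n) - g n\<bar> < e"
      by eventually_elim simp
    then obtain N where N: "\<And>n. n \<ge> N \<Longrightarrow> e < \<bar>g n - x\<bar> \<and> \<bar>g (Suc n) - g n\<bar> < e"
      by (auto simp: eventually_sequentially)
    have "\<not> (\<forall>n\<ge>N. x \<le> g n)"
    proof
      assume "\<forall>n\<ge>N. x \<le> g n"
      then have "ereal x \<le> liminf (\<lambda>n. ereal (g n))"
        by (intro Liminf_bounded eventually_sequentiallyI[of N]) auto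
      then show False using liminf by simp
    qed
    then obtain m where m: "m \<ge> N" "g m < x" by (auto simp: not_le)
    have "g n < x" if "n \<ge> m" for n
      using that
    proof (induction n rule: dec_induct)
      case (step n)
      then show ?case using N[of n] m(1) by linarith
    qed (rule m)
    then have "limsup (\<lambda>n. ereal (g n)) \<le> ereal x"
      by (intro Limsup_bounded eventually_sequentiallyI[of m]) (auto intro: less_imp_le)
    then show False using limsup by simp
  qed
qed

lemma (in prob_space) indep_vars_reindex:
  assumes indep: "indep_vars N X (f ` I)" and inj: "inj_on f I"
  shows "indep_vars (\<lambda>i. N (f i)) (\<lambda>i. X (f i)) I"
  unfolding indep_vars_def2
proof (intro conjI ballI)
  show "random_variable (N (f i)) (X (f i))" if "i \<in> I" for i
    using indep that by (auto simp: indep_vars_def2)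
  let ?F = "\<lambda>k. {X k -` A \<inter> space M |A. A \<in> sets (N k)}"
  have F: "indep_sets ?F (f ` I)"
    using indep by (simp add: indep_vars_def2)
  show "indep_sets (\<lambda>i. ?F (f i)) I"
  proof (rule indep_setsI)
    show "?F (f i) \<subseteq> events" if "i \<in> I" for i
      using F that unfolding indep_sets_def by blast
    fix A J
    assume J: "J \<noteq> {}" "J \<subseteq> I" "finite J" and A: "\<forall>j\<in>J. A j \<in> ?F (f j)"
    have injJ: "inj_on f J" using inj J(2) by (rule inj_on_subset)
    let ?B = "\<lambda>k. A (the_inv_into J f k)"
    have "prob (\<Inter>k\<in>f ` J. ?B k) = (\<Prod>k\<in>f ` J. prob (?B k))"
      using J A injJ by (intro indep_setsD[OF F]) (auto simp: the_inv_into_f_f)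
    then show "prob (\<Inter>j\<in>J. A j) = (\<Prod>j\<in>J. prob (A j))"
      using injJ by (simp add: prod.reindex the_inv_into_f_f)
  qed
qed

text \<open>
  An i.i.d. sequence on any probability space has the product measure as its joint law. This
  carries almost sure statements from sequence space to the original variables, and also to the
  reflected coordinates on sequence space itself.
\<close>
lemma (in prob_space) AE_of_iid:
  fixes X :: "nat \<Rightarrow> 'a \<Rightarrow> real" and \<mu> :: "real measure"
  assumes indep: "indep_vars (\<lambda>_. borel) X UNIV" and law: "\<And>i. distr M borel (X i) = \<mu>"
    and AE: "AE y in PiM UNIV (\<lambda>_. \<mu>). P y"
  shows "AE \<omega> in M. P (\<lambda>i. X i \<omega>)"
proof -
  have rv: "random_variable borel (X i)" for i
    using indep by (auto simp: indep_vars_def)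
  then have "distr M (PiM UNIV (\<lambda>_. borel)) (\<lambda>\<omega> i. X i \<omega>) = PiM UNIV (\<lambda>_. \<mu>)"
    using indep_vars_iff_distr_eq_PiM[where I = UNIV and M' = "\<lambda>_. borel" and X = X] indep law
    by (simp add: restrict_UNIV)
  moreover have "(\<lambda>\<omega> i. X i \<omega>) \<in> measurable M (PiM UNIV (\<lambda>_. borel))"
    by (rule measurable_PiM_single') (use rv in auto)
  ultimately show ?thesis
    using AE_distrD[of "\<lambda>\<omega> i. X i \<omega>" M "PiM UNIV (\<lambda>_. borel)" P] AE by metis
qed

lemma centre_minus: "centre (\<lambda>i. - y i) n = - centre y n"
  by (simp add: centre_def walk_def sum_negf)

lemma liminf_centre: "liminf (\<lambda>n. ereal (centre y n)) = - limsup_centre (\<lambda>i. - y i)"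
  using ereal_Limsup_uminus[of sequentially "\<lambda>n. ereal (centre y n)"]
  by (simp add: limsup_centre_def centre_minus)

context iid_sequence begin

lemma reflected_mean_0:
  assumes "integrable \<mu> (\<lambda>x. x)" and "expectation (\<lambda>x. x) = 0"
    and nondegenerate: "\<not> (AE x in \<mu>. x = 0)"
  shows "integrable (distr \<mu> borel uminus) (\<lambda>x. x)"
    and "(LINT x|distr \<mu> borel uminus. x) = 0"
    and "\<not> (AE x in distr \<mu> borel uminus. x = 0)"
proof -
  have "integrable (distr \<mu> borel uminus) (\<lambda>x. x) \<longleftrightarrow> integrable \<mu> (\<lambda>x. - x)"
    by (rule integrable_distr_eq) simp_all
  then show "integrable (distr \<mu> borel uminus) (\<lambda>x. x)"
    using Bochner_Integration.integrable_minus[OF assms(1)] by blast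
  show "(LINT x|distr \<mu> borel uminus. x) = 0"
    using assms(2) by (simp add: integral_distr)
  show "\<not> (AE x in distr \<mu> borel uminus. x = 0)"
    using nondegenerate by (simp add: AE_distr_iff)
qed

lemma iid_reflected: "iid_sequence (distr \<mu> borel uminus)"
  by (intro iid_sequence.intro real_distribution_distr) simp

lemma indep_reflected: "S.indep_vars (\<lambda>_. borel) (\<lambda>i y. - y i) UNIV"
  by (rule S.indep_vars_compose2[OF indep_coords]) auto

lemma distr_reflected_coord: "distr S borel (\<lambda>y. - y i) = distr \<mu> borel uminus"
proof -
  have "distr S borel (\<lambda>y. - y i) = distr (distr S borel (\<lambda>y. y i)) borel uminus"
    by (subst distr_distr) (auto simp: comp_def)
  then show ?thesis by (simp add: distr_coord)
qed

lemmas AE_reflected = S.AE_of_iid[OF indep_reflected distr_reflected_coord]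

text \<open>
  Reflection is an involution, so almost sure statements about reflected sequences can be carried
  back to the reflected law.
\<close>
lemma reflected_limsup_not_minus_infinity:
  assumes "\<not> (AE y in PiM UNIV (\<lambda>_. distr \<mu> borel uminus). limsup_centre y = -\<infinity>)"
  shows "\<not> (AE y in S. limsup_centre (\<lambda>i. - y i) = -\<infinity>)"
proof
  interpret R: iid_sequence "distr \<mu> borel uminus" by (rule iid_reflected)
  assume AE: "AE y in S. limsup_centre (\<lambda>i. - y i) = -\<infinity>"
  have involution: "distr (distr \<mu> borel uminus) borel uminus = \<mu>"
    by (subst distr_distr) (auto simp: comp_def intro: distr_id2)
  have "AE y in PiM UNIV (\<lambda>_. distr (distr \<mu> borel uminus) borel uminus). limsup_centre (\<lambda>i. - y i) = -\<infinity>"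
    unfolding involution by (rule AE)
  then have "AE y in R.S. limsup_centre (\<lambda>i. - (- y i)) = -\<infinity>"
    by (rule R.AE_reflected)
  then show False using assms by simp
qed

text \<open>
  The dichotomy for the upper limit is applied to the law and to its reflection; the latter gives
  the lower limit.
\<close>
lemma centre_oscillates:
  assumes "integrable \<mu> (\<lambda>x. x)" and "expectation (\<lambda>x. x) = 0"
    and nondegenerate: "\<not> (AE x in \<mu>. x = 0)"
    and upward: "\<not> (AE y in S. limsup_centre y = -\<infinity>)"
    and downward: "\<not> (AE y in S. limsup_centre (\<lambda>i. - y i) = -\<infinity>)"
  shows "AE y in S. limsup (\<lambda>n. ereal (centre y n)) = \<infinity> \<and> liminf (\<lambda>n. ereal (centre y n)) = -\<infinity> \<and>
    (\<forall>x. liminf (\<lambda>n. ereal \<bar>centre y n - x\<bar>) = 0)"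
proof -
  interpret R: iid_sequence "distr \<mu> borel uminus" by (rule iid_reflected)
  have "AE y in S. limsup_centre y = \<infinity>"
    using limsup_centre_infinite[OF assms(1-3)] upward by blast
  moreover have "AE y in S. limsup_centre (\<lambda>i. - y i) = \<infinity>"
  proof -
    have "(AE y in R.S. limsup_centre y = \<infinity>) \<or> (AE y in R.S. limsup_centre y = -\<infinity>)"
      using reflected_mean_0[OF assms(1-3)] by (rule R.limsup_centre_infinite)
    then show ?thesis
      using AE_reflected[of "\<lambda>y. limsup_centre y = \<infinity>"] AE_reflected[of "\<lambda>y. limsup_centre y = -\<infinity>"] downward
      by blast
  qed
  ultimately show ?thesis
    using strong_law[OF assms(1,2)]
  proof eventually_elim
    case (elim y)
    have "limsup (\<lambda>n. ereal (centre y n)) = \<infinity>" "liminf (\<lambda>n. ereal (centre y n)) = -\<infinity>"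
      using elim(1,2) by (simp_all add: liminf_centre limsup_centre_def[of y, symmetric])
    then show ?case
      using liminf_dist_eq_0_of_oscillation[OF _ _ centre_increments[OF elim(3)]] by blast
  qed
qed

text \<open>
  By symmetry the reflected sequence would also have upper limit \<open>-\<infinity>\<close>. The lower limit would
  then be \<open>\<infinity>\<close> and exceed the upper one.
\<close>
lemma symmetric_limsup_not_minus_infinity:
  assumes symmetric: "distr \<mu> borel uminus = \<mu>"
  shows "\<not> (AE y in S. limsup_centre y = -\<infinity>)"
proof
  assume AE: "AE y in S. limsup_centre y = -\<infinity>"
  then have "AE y in S. limsup_centre (\<lambda>i. - y i) = -\<infinity>"
    using AE_reflected unfolding symmetric by blast
  with AE have "AE y in S. False"
  proof eventually_elim
    case (elim y)
    have "liminf (\<lambda>n. ereal (centre y n)) \<le> limsup (\<lambda>n. ereal (centre y n))"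
      by (rule Liminf_le_Limsup) simp
    then show ?case
      using elim by (simp add: liminf_centre limsup_centre_def[of y, symmetric])
  qed
  then show False by simp
qed

end

section \<open>The centre of mass of an i.i.d. walk\<close>

lemma avg_partial_sum_eq_centre: "avg_partial_sum Xs n \<omega> = centre (\<lambda>i. Xs (Suc i) \<omega>) n"
  by (simp add: avg_partial_sum_def partial_sum_def centre_def walk_def sum.atLeast1_atMost_eq)

theorem theorem1p5:
  fixes M :: "'a measure"
    and X :: "'a \<Rightarrow> real"
    and Xs :: "nat \<Rightarrow> 'a \<Rightarrow> real"
  assumes "prob_space M"
    and "iid_copies M X Xs"
    and "(integrable M X \<and> prob_space.expectation M (\<lambda>\<omega>. \<bar>X \<omega>\<bar>) > 0 \<and>
            distr M borel X = distr M borel (\<lambda>\<omega>. - X \<omega>)) \<or>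
         (integrable M (\<lambda>\<omega>. (X \<omega>)\<^sup>2) \<and> prob_space.variance M X > 0 \<and>
            prob_space.expectation M X = 0)"
  shows "(AE \<omega> in M. liminf (\<lambda>n. ereal (avg_partial_sum Xs n \<omega>)) = -\<infinity> \<and>
                      limsup (\<lambda>n. ereal (avg_partial_sum Xs n \<omega>)) = \<infinity>) \<and>
         (\<forall>x::real. AE \<omega> in M. liminf (\<lambda>n. ereal \<bar>avg_partial_sum Xs n \<omega> - x\<bar>) = 0)"
proof -
  interpret M: prob_space M by fact
  define \<mu> where "\<mu> = distr M borel X"
  have X [measurable]: "X \<in> borel_measurable M"
    and indep: "M.indep_vars (\<lambda>_. borel) Xs {1..}"
    and law: "\<And>i. i \<ge> 1 \<Longrightarrow> distr M borel (Xs i) = \<mu>"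
    using assms(2) by (auto simp: iid_copies_def \<mu>_def)
  interpret real_distribution \<mu>
    unfolding \<mu>_def by (rule M.real_distribution_distr) simp
  interpret iid_sequence \<mu> by unfold_locales
  have integral: "expectation f = M.expectation (\<lambda>\<omega>. f (X \<omega>))" if "f \<in> borel_measurable borel" for f :: "real \<Rightarrow> real"
    using that by (simp add: \<mu>_def integral_distr)
  have integrable: "integrable \<mu> f \<longleftrightarrow> integrable M (\<lambda>\<omega>. f (X \<omega>))" if "f \<in> borel_measurable borel" for f :: "real \<Rightarrow> real"
    using that by (simp add: \<mu>_def integrable_distr_eq)
  have reflected: "distr \<mu> borel uminus = distr M borel (\<lambda>\<omega>. - X \<omega>)"
    unfolding \<mu>_def by (subst distr_distr) (auto simp: comp_def)
  have "AE y in S. limsup (\<lambda>n. ereal (centre y n)) = \<infinity> \<and> liminf (\<lambda>n. ereal (centre y n)) = -\<infinity> \<and>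
    (\<forall>x. liminf (\<lambda>n. ereal \<bar>centre y n - x\<bar>) = 0)"
    using assms(3)
  proof (elim disjE conjE)
    assume int: "integrable M X" and pos: "M.expectation (\<lambda>\<omega>. \<bar>X \<omega>\<bar>) > 0"
      and sym: "distr M borel X = distr M borel (\<lambda>\<omega>. - X \<omega>)"
    have symmetric: "distr \<mu> borel uminus = \<mu>"
      using reflected sym by (simp add: \<mu>_def)
    show ?thesis
    proof (rule centre_oscillates)
      show int_\<mu>: "integrable \<mu> (\<lambda>x. x)" using int by (simp add: integrable)
      have "expectation (\<lambda>x. x) = (LINT x|distr \<mu> borel uminus. x)" by (simp add: symmetric)
      also have "\<dots> = - expectation (\<lambda>x. x)" by (simp add: integral_distr)
      finally show "expectation (\<lambda>x. x) = 0" by simp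
      show "\<not> (AE x in \<mu>. x = 0)"
      proof
        assume "AE x in \<mu>. x = 0"
        then have "expectation (\<lambda>x. \<bar>x\<bar>) = 0"
          by (intro integral_eq_zero_AE) auto
        then show False using pos by (simp add: integral)
      qed
      show "\<not> (AE y in S. limsup_centre y = -\<infinity>)"
        using symmetric by (rule symmetric_limsup_not_minus_infinity)
      then show "\<not> (AE y in S. limsup_centre (\<lambda>i. - y i) = -\<infinity>)"
        using reflected_limsup_not_minus_infinity unfolding symmetric by blast
    qed
  next
    assume sq: "integrable M (\<lambda>\<omega>. (X \<omega>)\<^sup>2)" and var: "M.variance X > 0" and mean: "M.expectation X = 0"
    have second_moment: "expectation (\<lambda>x. x\<^sup>2) > 0"
      using var mean by (simp add: integral)
    have "integrable \<mu> (\<lambda>x. x\<^sup>2)" by (subst integrable) (use sq in simp_all)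
    moreover have "expectation (\<lambda>x. x) = 0" by (subst integral) (use mean in simp_all)
    ultimately interpret square_integrable_iid_sequence \<mu>
      using second_moment by unfold_locales
    have "integrable (distr \<mu> borel uminus) (\<lambda>x. x\<^sup>2)"
      using square_integrable by (simp add: integrable_distr_eq)
    moreover have "(LINT x|distr \<mu> borel uminus. x) = 0"
      using mean_0 by (simp add: integral_distr)
    moreover have "(LINT x|distr \<mu> borel uminus. x\<^sup>2) > 0"
      using second_moment by (simp add: integral_distr)
    ultimately interpret R: square_integrable_iid_sequence "distr \<mu> borel uminus"
      by (intro square_integrable_iid_sequence.intro iid_reflected square_integrable_iid_sequence_axioms.intro)
    show ?thesis
    proof (rule centre_oscillates[OF integrable_id mean_0])
      show "\<not> (AE x in \<mu>. x = 0)"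
      proof
        assume "AE x in \<mu>. x = 0"
        then have "expectation (\<lambda>x. x\<^sup>2) = 0"
          by (intro integral_eq_zero_AE) auto
        then show False using second_moment by simp
      qed
      show "\<not> (AE y in S. limsup_centre y = -\<infinity>)"
        by (rule limsup_centre_not_minus_infinity)
      show "\<not> (AE y in S. limsup_centre (\<lambda>i. - y i) = -\<infinity>)"
        by (rule reflected_limsup_not_minus_infinity[OF R.limsup_centre_not_minus_infinity])
    qed
  qed
  then have "AE \<omega> in M. limsup (\<lambda>n. ereal (avg_partial_sum Xs n \<omega>)) = \<infinity> \<and>
      liminf (\<lambda>n. ereal (avg_partial_sum Xs n \<omega>)) = -\<infinity> \<and>
      (\<forall>x. liminf (\<lambda>n. ereal \<bar>avg_partial_sum Xs n \<omega> - x\<bar>) = 0)"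
    unfolding avg_partial_sum_eq_centre
  proof (rule M.AE_of_iid[rotated 2])
    show "M.indep_vars (\<lambda>_. borel) (\<lambda>i. Xs (Suc i)) UNIV"
      using M.indep_vars_reindex[of "\<lambda>_. borel" Xs Suc UNIV] M.indep_vars_subset[OF indep, of "range Suc"]
      by auto
    show "distr M borel (Xs (Suc i)) = \<mu>" for i
      by (rule law) simp
  qed
  then have "AE \<omega> in M. limsup (\<lambda>n. ereal (avg_partial_sum Xs n \<omega>)) = \<infinity>"
    and "AE \<omega> in M. liminf (\<lambda>n. ereal (avg_partial_sum Xs n \<omega>)) = -\<infinity>"
    and "AE \<omega> in M. liminf (\<lambda>n. ereal \<bar>avg_partial_sum Xs n \<omega> - x\<bar>) = 0" for x
    by (eventually_elim, blast)+
  then show ?thesis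
    by (intro conjI allI AE_conjI)
qed

end
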